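(* Let $f\in\mathcal{K}$ be an entire function of order $\rho(f)\le\infty$. Then $$\liminf_{t\to\infty}\frac{\sigma_f^2(t)}{m_f(t)}\le\liminf_{t\to\infty}\frac{\ln m_f(t)}{\ln t}\le\liminf_{t\to\infty}\frac{\ln\ln f(t)}{\ln t}\le\limsup_{t\to\infty}\frac{\ln\ln f(t)}{\ln t}=\limsup_{t\to\infty}\frac{\ln m_f(t)}{\ln t}=\rho(f)\le\limsup_{t\to\infty}\frac{\sigma_f^2(t)}{m_f(t)},$$ where all quantities take values in the extended real line.
   Context: $\mathcal{K}$ is the class of nonconstant power series $f(z)=\sum_{n=0}^\infty a_nz^n$ with positive radius of convergence $R\le\infty$, with all $a_n\ge 0$ and with $a_0>0$; $f$ entire means $R=\infty$. The associated (Khinchin) family $(X_t)_{t\ge 0}$ of an entire $f\in\mathcal{K}$ consists of random variables with values in $\{0,1,2,\dots\}$, with $X_0\equiv 0$ and $\mathbf{P}(X_t=n)=a_nt^n/f(t)$ for $t>0$, $n\ge 0$. Its mean and variance are $m_f(t)=\mathbf{E}(X_t)=tf'(t)/f(t)$ and $\sigma_f^2(t)=\mathbf{V}(X_t)=t\,m_f'(t)$. The order of an entire $f\in\mathcal{K}$ is $\rho(f)=\limsup_{t\to\infty}\frac{\ln\ln\max_{|z|=t}|f(z)|}{\ln t}=\limsup_{t\to\infty}\frac{\ln\ln f(t)}{\ln t}\in[0,+\infty]$. *)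

theory Defs
  imports "HOL-Analysis.Analysis" "HOL-Probability.Probability"
begin

definition khinchin_class :: "real fps set" where
  "khinchin_class =
     {f. fps_conv_radius f > 0 \<and> (\<forall>n. fps_nth f n \<ge> 0) \<and> fps_nth f 0 > 0 \<and>
         (\<exists>n\<ge>1. fps_nth f n \<noteq> 0)}"

definition entire_fps :: "real fps \<Rightarrow> bool" where
  "entire_fps f \<longleftrightarrow> fps_conv_radius f = \<infinity>"

(* The law of X_t, for 0 <= t < R.  Since 0 ^ 0 = 1, for t = 0 it is the point mass at 0.
   For t outside this range embed_pmf is applied to a function that need not be a
   probability mass function, and the value is meaningless. *)
definition khinchin_pmf :: "real fps \<Rightarrow> real \<Rightarrow> nat pmf" where
  "khinchin_pmf f t = embed_pmf (\<lambda>n. fps_nth f n * t ^ n / eval_fps f t)"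

definition khinchin_mean :: "real fps \<Rightarrow> real \<Rightarrow> real" where
  "khinchin_mean f t = measure_pmf.expectation (khinchin_pmf f t) real"

definition khinchin_variance :: "real fps \<Rightarrow> real \<Rightarrow> real" where
  "khinchin_variance f t = measure_pmf.variance (khinchin_pmf f t) real"

definition complex_fps :: "real fps \<Rightarrow> complex fps" where
  "complex_fps f = Abs_fps (\<lambda>n. complex_of_real (fps_nth f n))"

(* The supremum is a maximum, because the circle is compact and nonempty for t >= 0. *)
definition max_modulus :: "real fps \<Rightarrow> real \<Rightarrow> real" where
  "max_modulus f t = (SUP z\<in>sphere 0 t. norm (eval_fps (complex_fps f) z))"

(* For nonconstant f, the iterated logarithm is meaningful for all large t,
   so the conventions for ln and division outside their domains play no role. *)
definition fps_order :: "real fps \<Rightarrow> ereal" where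
  "fps_order f = Limsup at_top (\<lambda>t. ereal (ln (ln (max_modulus f t)) / ln t))"


lemma khinchin_summable:
  assumes "0 \<le> t" "ereal t < fps_conv_radius f"
  shows "summable (\<lambda>n. fps_nth f n * t ^ n)"
  using assms by (intro summable_fps) auto

lemma eval_fps_pos:
  assumes "f \<in> khinchin_class" "0 \<le> t" "ereal t < fps_conv_radius f"
  shows "eval_fps f t > 0"
proof -
  have "0 < fps_nth f 0 * t ^ 0" using assms(1) by (simp add: khinchin_class_def)
  also have "\<dots> \<le> (\<Sum>n. fps_nth f n * t ^ n)"
    using sum_le_suminf[OF khinchin_summable[OF assms(2,3)], of "{0}"] assms
    by (auto simp: khinchin_class_def)
  finally show ?thesis by (simp add: eval_fps_def)
qed

lemma pmf_khinchin_pmf: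
  assumes "f \<in> khinchin_class" "0 \<le> t" "ereal t < fps_conv_radius f"
  shows "pmf (khinchin_pmf f t) n = fps_nth f n * t ^ n / eval_fps f t"
  unfolding khinchin_pmf_def
proof (rule pmf_embed_pmf)
  let ?g = "\<lambda>n. fps_nth f n * t ^ n / eval_fps f t"
  have pos: "eval_fps f t > 0" by (rule eval_fps_pos[OF assms])
  show nn: "0 \<le> ?g n" for n
    using assms(1,2) pos by (simp add: khinchin_class_def)
  have "(\<integral>\<^sup>+ n. ennreal (?g n) \<partial>count_space UNIV) = (\<Sum>n. ennreal (?g n))"
    by (rule nn_integral_count_space_nat)
  also have "\<dots> = ennreal (\<Sum>n. ?g n)"
    using nn khinchin_summable[OF assms(2,3)] by (intro suminf_ennreal2 summable_divide) auto
  also have "(\<Sum>n. ?g n) = 1"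
    using suminf_divide[OF khinchin_summable[OF assms(2,3)], of "eval_fps f t"] pos
    by (simp add: eval_fps_def)
  finally show "(\<integral>\<^sup>+ n. ennreal (?g n) \<partial>count_space UNIV) = 1" by simp
qed

lemma expectation_nat_pmf:
  fixes p :: "nat pmf" and g :: "nat \<Rightarrow> real"
  assumes g: "\<And>n. g n \<ge> 0" and s: "(\<lambda>n. pmf p n * g n) sums S"
  shows "integrable (measure_pmf p) g" "measure_pmf.expectation p g = S"
proof -
  have i: "integrable (count_space UNIV) (\<lambda>n. pmf p n * g n)"
    using s g by (simp add: integrable_count_space_nat_iff sums_iff abs_mult)
  show "integrable (measure_pmf p) g"
    unfolding measure_pmf_eq_density using i by (subst integrable_density) auto
  have "measure_pmf.expectation p g = (\<integral>n. pmf p n * g n \<partial>count_space UNIV)"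
    unfolding measure_pmf_eq_density by (subst integral_density) auto
  also have "\<dots> = S" using sums_integral_count_space_nat[OF i] s by (rule sums_unique2)
  finally show "measure_pmf.expectation p g = S" .
qed

definition euler_deriv :: "real fps \<Rightarrow> real fps" where
  "euler_deriv f = fps_X * fps_deriv f"

lemma nth_euler_deriv: "fps_nth (euler_deriv f) n = real n * fps_nth f n"
  by (cases n) (simp_all add: euler_deriv_def)

lemma conv_radius_euler_deriv: "fps_conv_radius f \<le> fps_conv_radius (euler_deriv f)"
  using fps_conv_radius_deriv[of f] fps_conv_radius_mult[of fps_X "fps_deriv f"]
  by (auto simp: euler_deriv_def)

lemma eval_euler_deriv:
  assumes "ereal \<bar>t\<bar> < fps_conv_radius f"
  shows "eval_fps (euler_deriv f) t = t * eval_fps (fps_deriv f) t"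
  unfolding euler_deriv_def using assms fps_conv_radius_deriv[of f]
  by (subst eval_fps_mult) auto

lemma khinchin_moments:
  assumes "f \<in> khinchin_class" "0 \<le> t" "ereal t < fps_conv_radius f"
  shows "integrable (measure_pmf (khinchin_pmf f t)) real"
    and "khinchin_mean f t = eval_fps (euler_deriv f) t / eval_fps f t"
    and "integrable (measure_pmf (khinchin_pmf f t)) (\<lambda>n. (real n)\<^sup>2)"
    and "measure_pmf.expectation (khinchin_pmf f t) (\<lambda>n. (real n)\<^sup>2) =
           eval_fps (euler_deriv (euler_deriv f)) t / eval_fps f t"
proof -
  have r1: "ereal (norm t) < fps_conv_radius (euler_deriv f)"
    using assms conv_radius_euler_deriv[of f] by auto
  then have r2: "ereal (norm t) < fps_conv_radius (euler_deriv (euler_deriv f))"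
    using conv_radius_euler_deriv[of "euler_deriv f"] by auto
  have s1: "(\<lambda>n. pmf (khinchin_pmf f t) n * real n) sums (eval_fps (euler_deriv f) t / eval_fps f t)"
    using sums_divide[OF sums_eval_fps[OF r1], of "eval_fps f t"]
    by (simp add: pmf_khinchin_pmf[OF assms] nth_euler_deriv mult_ac)
  have s2: "(\<lambda>n. pmf (khinchin_pmf f t) n * (real n)\<^sup>2) sums
      (eval_fps (euler_deriv (euler_deriv f)) t / eval_fps f t)"
    using sums_divide[OF sums_eval_fps[OF r2], of "eval_fps f t"]
    by (simp add: pmf_khinchin_pmf[OF assms] nth_euler_deriv mult_ac power2_eq_square)
  show "integrable (measure_pmf (khinchin_pmf f t)) real"
    "khinchin_mean f t = eval_fps (euler_deriv f) t / eval_fps f t"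
    "integrable (measure_pmf (khinchin_pmf f t)) (\<lambda>n. (real n)\<^sup>2)"
    "measure_pmf.expectation (khinchin_pmf f t) (\<lambda>n. (real n)\<^sup>2) =
           eval_fps (euler_deriv (euler_deriv f)) t / eval_fps f t"
    using expectation_nat_pmf[OF _ s1] expectation_nat_pmf[OF _ s2]
    by (auto simp: khinchin_mean_def)
qed

lemma khinchin_mean_eq:
  assumes "f \<in> khinchin_class" "0 \<le> t" "ereal t < fps_conv_radius f"
  shows "khinchin_mean f t = t * deriv (eval_fps f) t / eval_fps f t"
  using khinchin_moments(2)[OF assms] assms eval_euler_deriv[of t f] eval_fps_deriv[of t f]
  by simp

lemma khinchin_mean_has_derivative:
  assumes f: "f \<in> khinchin_class" and t: "0 < t" "ereal t < fps_conv_radius f"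
  shows "(khinchin_mean f has_real_derivative khinchin_variance f t / t) (at t)"
proof -
  have t0: "0 \<le> t" using t by simp
  let ?F = "eval_fps f" and ?G = "eval_fps (euler_deriv f)"
  have pos: "?F t > 0" by (rule eval_fps_pos[OF f t0 t(2)])
  have r1: "ereal (norm t) < fps_conv_radius f" using t by simp
  have r2: "ereal (norm t) < fps_conv_radius (euler_deriv f)"
    using r1 conv_radius_euler_deriv[of f] by auto
  have F': "eval_fps (fps_deriv f) t = ?G t / t"
    using eval_euler_deriv[of t f] r1 t by simp
  have G': "eval_fps (fps_deriv (euler_deriv f)) t = eval_fps (euler_deriv (euler_deriv f)) t / t"
    using eval_euler_deriv[of t "euler_deriv f"] r2 t by simp
  have v: "khinchin_variance f t =
      eval_fps (euler_deriv (euler_deriv f)) t / ?F t - (?G t / ?F t)\<^sup>2"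
    unfolding khinchin_variance_def
    using measure_pmf.variance_eq[OF khinchin_moments(1,3)[OF f t0 t(2)]]
      khinchin_moments(2,4)[OF f t0 t(2)] by (simp add: khinchin_mean_def)
  have d: "((\<lambda>s. ?G s / ?F s) has_real_derivative
      (?G t * - (?F t powi -2 * (?G t / t)) + eval_fps (euler_deriv (euler_deriv f)) t / t / ?F t)) (at t)"
    using has_field_derivative_eval_fps[OF r1, of UNIV] has_field_derivative_eval_fps[OF r2, of UNIV] pos
    unfolding F' G'
    by (auto intro!: derivative_eq_intros simp: field_simps power_int_minus power2_eq_square)
  have e: "?G t * - (?F t powi -2 * (?G t / t)) + eval_fps (euler_deriv (euler_deriv f)) t / t / ?F t
      = khinchin_variance f t / t"
    unfolding v using pos t by (simp add: field_simps power_int_minus power2_eq_square)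
  have o: "open ({0::real<..} \<inter> eball 0 (fps_conv_radius f))"
    by (intro open_Int open_greaterThan open_eball)
  show ?thesis
    by (rule has_field_derivative_transform_within_open[OF d[unfolded e] o])
      (use t in \<open>auto simp: khinchin_moments(2)[OF f]\<close>)
qed

lemma khinchin_variance_eq:
  assumes "f \<in> khinchin_class" "0 < t" "ereal t < fps_conv_radius f"
  shows "khinchin_variance f t = t * deriv (khinchin_mean f) t"
  using DERIV_imp_deriv[OF khinchin_mean_has_derivative[OF assms]] assms(2) by simp

lemma max_modulus_eq:
  assumes "f \<in> khinchin_class" "0 \<le> t" "ereal t < fps_conv_radius f"
  shows "max_modulus f t = eval_fps f t"
proof -
  have le: "norm (eval_fps (complex_fps f) z) \<le> eval_fps f t" if "z \<in> sphere 0 t" for z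
  proof -
    have eq: "norm (fps_nth (complex_fps f) n * z ^ n) = fps_nth f n * t ^ n" for n
      using that assms(1)
      by (simp add: complex_fps_def norm_mult norm_power khinchin_class_def)
    have "norm (\<Sum>n. fps_nth (complex_fps f) n * z ^ n) \<le> (\<Sum>n. fps_nth f n * t ^ n)"
      using summable_norm[of "\<lambda>n. fps_nth (complex_fps f) n * z ^ n"]
        khinchin_summable[OF assms(2,3)] by (simp add: eq)
    then show ?thesis by (simp add: eval_fps_def)
  qed
  have "eval_fps (complex_fps f) (complex_of_real t) = complex_of_real (eval_fps f t)"
    using suminf_of_real[OF khinchin_summable[OF assms(2,3)], where 'a = complex]
    by (simp add: eval_fps_def complex_fps_def)
  then have "eval_fps f t = norm (eval_fps (complex_fps f) (complex_of_real t))"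
    using eval_fps_pos[OF assms] by simp
  then show ?thesis
    unfolding max_modulus_def using le assms(2)
    by (intro cSup_eq_maximum) (auto intro!: image_eqI[of _ _ "complex_of_real t"])
qed

end

theory Submission
  imports Defs "HOL-Real_Asymp.Real_Asymp"
begin

text \<open>
  In the variable \<open>u = ln t\<close> the derivative of \<open>ln m\<close> is \<open>\<sigma>\<^sup>2 / m\<close> and that of
  \<open>L = ln f\<close> is \<open>m\<close>. The first and the last inequality are therefore the one-sided rule of
  l'Hospital for \<open>ln m / ln t\<close>. Since \<open>m\<close> is increasing, integration of \<open>L' = m / t\<close> gives
  \<open>m t \<le> L (e t)\<close> and \<open>L t \<le> L 1 + m t ln t\<close> for large \<open>t\<close>; on the
  scale of \<open>ln t\<close>, neither the dilation by \<open>e\<close> nor the factor \<open>ln t\<close> is visible.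
\<close>

section \<open>Comparison of upper and lower limits up to a vanishing error\<close>

text \<open>Testing against real bounds \<open>b\<close> spares a case distinction for infinite
  limits. The error \<open>r\<close> may depend on \<open>b\<close>, as it must later on: typical
  errors are constants built from \<open>b\<close>, divided by \<open>ln t\<close>.\<close>

lemma Limsup_le_Limsup_vanishing_error:
  fixes X Y :: "'a \<Rightarrow> real"
  assumes "\<And>b. \<forall>\<^sub>F t in F. Y t < b \<Longrightarrow> \<exists>r. (r \<longlongrightarrow> 0) F \<and> (\<forall>\<^sub>F t in F. X t \<le> b + r t)"
  shows "Limsup F (\<lambda>t. ereal (X t)) \<le> Limsup F (\<lambda>t. ereal (Y t))"
proof (rule ccontr)
  assume "\<not> ?thesis"
  then obtain b where b: "Limsup F (\<lambda>t. ereal (Y t)) < ereal b" "ereal b < Limsup F (\<lambda>t. ereal (X t))"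
    using ereal_dense2 by (meson not_le)
  \<comment> \<open>A second separating number leaves the room \<open>c - b > 0\<close> into which
    the error eventually fits.\<close>
  then obtain c where c: "ereal b < ereal c" "ereal c < Limsup F (\<lambda>t. ereal (X t))"
    using ereal_dense2 by blast
  have "\<forall>\<^sub>F t in F. Y t < b"
    using Limsup_lessD[OF b(1)] by simp
  then obtain r where r: "(r \<longlongrightarrow> 0) F" "\<forall>\<^sub>F t in F. X t \<le> b + r t"
    using assms by blast
  have "\<forall>\<^sub>F t in F. r t < c - b"
    using order_tendstoD(2)[OF r(1), of "c - b"] c(1) by simp
  with r(2) have "\<forall>\<^sub>F t in F. ereal (X t) \<le> ereal c"
    by eventually_elim simp
  then show False
    using Limsup_bounded[of "\<lambda>t. ereal (X t)" "ereal c" F] c(2) by simp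
qed

lemma Liminf_le_Liminf_vanishing_error:
  fixes X Y :: "'a \<Rightarrow> real"
  assumes "\<And>b. \<forall>\<^sub>F t in F. b < X t \<Longrightarrow> \<exists>r. (r \<longlongrightarrow> 0) F \<and> (\<forall>\<^sub>F t in F. b + r t \<le> Y t)"
  shows "Liminf F (\<lambda>t. ereal (X t)) \<le> Liminf F (\<lambda>t. ereal (Y t))"
proof -
  have "Limsup F (\<lambda>t. ereal (- Y t)) \<le> Limsup F (\<lambda>t. ereal (- X t))"
  proof (rule Limsup_le_Limsup_vanishing_error)
    fix b assume "\<forall>\<^sub>F t in F. - X t < b"
    then have "\<forall>\<^sub>F t in F. - b < X t"
      by eventually_elim simp
    then obtain r where r: "(r \<longlongrightarrow> 0) F" "\<forall>\<^sub>F t in F. - b + r t \<le> Y t"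
      using assms by blast
    from r(2) have "\<forall>\<^sub>F t in F. - Y t \<le> b + - r t"
      by eventually_elim simp
    then show "\<exists>r. (r \<longlongrightarrow> 0) F \<and> (\<forall>\<^sub>F t in F. - Y t \<le> b + r t)"
      using tendsto_minus[OF r(1)] by (intro exI[of _ "\<lambda>t. - r t"]) simp
  qed
  then show ?thesis
    using ereal_Limsup_uminus[of F "\<lambda>t. ereal (X t)"] ereal_Limsup_uminus[of F "\<lambda>t. ereal (Y t)"]
    by simp
qed

section \<open>Growth bounds from the derivative with respect to \<open>ln x\<close>\<close>

text \<open>This is the mean value inequality in the variable \<open>ln x\<close>, in which
  \<open>h'\<close> is the derivative of \<open>h\<close>: the function
  \<open>h x - b * ln x\<close> is nondecreasing.\<close>

lemma mult_ln_le_diff: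
  fixes h h' :: "real \<Rightarrow> real"
  assumes "0 < s" "s \<le> t"
    and der: "\<And>x. s \<le> x \<Longrightarrow> x \<le> t \<Longrightarrow> (h has_real_derivative h' x / x) (at x)"
    and le: "\<And>x. s \<le> x \<Longrightarrow> x \<le> t \<Longrightarrow> b \<le> h' x"
  shows "b * (ln t - ln s) \<le> h t - h s"
proof -
  have "h s - b * ln s \<le> h t - b * ln t"
  proof (rule DERIV_nonneg_imp_nondecreasing[OF assms(2)])
    fix x assume x: "s \<le> x" "x \<le> t"
    then have "((\<lambda>x. h x - b * ln x) has_real_derivative (h' x - b) / x) (at x)"
      using assms(1) by (auto intro!: derivative_eq_intros der simp: diff_divide_distrib)
    then show "\<exists>y. ((\<lambda>x. h x - b * ln x) has_real_derivative y) (at x) \<and> 0 \<le> y"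
      using le[OF x] x assms(1) by (intro exI[of _ "(h' x - b) / x"]) simp
  qed
  then show ?thesis
    by (simp add: algebra_simps)
qed

lemma diff_le_mult_ln:
  fixes h h' :: "real \<Rightarrow> real"
  assumes "0 < s" "s \<le> t"
    and der: "\<And>x. s \<le> x \<Longrightarrow> x \<le> t \<Longrightarrow> (h has_real_derivative h' x / x) (at x)"
    and le: "\<And>x. s \<le> x \<Longrightarrow> x \<le> t \<Longrightarrow> h' x \<le> b"
  shows "h t - h s \<le> b * (ln t - ln s)"
proof -
  have "- b * (ln t - ln s) \<le> - h t - - h s"
    by (rule mult_ln_le_diff[where h' = "\<lambda>x. - h' x"])
      (use assms in \<open>auto intro!: derivative_eq_intros der\<close>)
  then show ?thesis
    by (simp add: algebra_simps)
qed

text \<open>Once \<open>h'\<close> stays above \<open>b\<close> from \<open>T\<close> on,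
  \<open>h t\<close> is at least \<open>b * ln t\<close> plus a constant depending on
  \<open>T\<close>, and division by \<open>ln t\<close> makes the constant vanish.\<close>

lemma Liminf_log_derivative_le:
  fixes h h' :: "real \<Rightarrow> real"
  assumes der: "\<And>x. 0 < x \<Longrightarrow> (h has_real_derivative h' x / x) (at x)"
  shows "Liminf at_top (\<lambda>t. ereal (h' t)) \<le> Liminf at_top (\<lambda>t. ereal (h t / ln t))"
proof (rule Liminf_le_Liminf_vanishing_error)
  fix b assume "\<forall>\<^sub>F t in at_top. b < h' t"
  then have "\<forall>\<^sub>F t in at_top. 1 < t \<and> b < h' t"
    by (rule eventually_conj[OF eventually_gt_at_top])
  then obtain T where T: "1 < T" "\<And>t. T \<le> t \<Longrightarrow> b < h' t"
    unfolding eventually_at_top_linorder by blast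
  let ?r = "\<lambda>t. (h T - b * ln T) / ln t"
  have "(?r \<longlongrightarrow> 0) at_top"
    by real_asymp
  moreover have "\<forall>\<^sub>F t in at_top. b + ?r t \<le> h t / ln t"
  proof (rule eventually_at_top_linorderI[of T])
    fix t assume t: "T \<le> t"
    have "b * (ln t - ln T) \<le> h t - h T"
      by (rule mult_ln_le_diff[where h' = h']) (use T t der in \<open>auto intro: less_imp_le\<close>)
    then have "(b * ln t + (h T - b * ln T)) / ln t \<le> h t / ln t"
      using T(1) t by (intro divide_right_mono) (simp_all add: algebra_simps)
    then show "b + ?r t \<le> h t / ln t"
      using T(1) t by (simp add: add_divide_distrib)
  qed
  ultimately show "\<exists>r. (r \<longlongrightarrow> 0) at_top \<and> (\<forall>\<^sub>F t in at_top. b + r t \<le> h t / ln t)"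
    by blast
qed

lemma Limsup_le_log_derivative:
  fixes h h' :: "real \<Rightarrow> real"
  assumes der: "\<And>x. 0 < x \<Longrightarrow> (h has_real_derivative h' x / x) (at x)"
  shows "Limsup at_top (\<lambda>t. ereal (h t / ln t)) \<le> Limsup at_top (\<lambda>t. ereal (h' t))"
proof -
  have "Liminf at_top (\<lambda>t. ereal (- h' t)) \<le> Liminf at_top (\<lambda>t. ereal (- h t / ln t))"
    by (rule Liminf_log_derivative_le) (auto intro!: derivative_eq_intros der)
  then show ?thesis
    using ereal_Liminf_uminus[of at_top "\<lambda>t. ereal (h t / ln t)"]
      ereal_Liminf_uminus[of at_top "\<lambda>t. ereal (h' t)"]
    by simp
qed

section \<open>Insensitivity to dilation\<close>

text \<open>Dilation by \<open>exp 1\<close> shifts \<open>ln t\<close> by 1, which costs only an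
  error \<plusminus>\<open>b / ln t\<close>.\<close>

lemma Liminf_Limsup_div_ln_le_dilated:
  fixes g h :: "real \<Rightarrow> real"
  assumes le: "\<forall>\<^sub>F t in at_top. g t \<le> h (exp 1 * t)"
  shows "Liminf at_top (\<lambda>t. ereal (g t / ln t)) \<le> Liminf at_top (\<lambda>t. ereal (h t / ln t))"
    and "Limsup at_top (\<lambda>t. ereal (g t / ln t)) \<le> Limsup at_top (\<lambda>t. ereal (h t / ln t))"
proof -
  have r: "((\<lambda>t. c / ln t) \<longlongrightarrow> 0) at_top" for c :: real
    by real_asymp
  have scale: "filterlim (\<lambda>t::real. exp 1 * t) at_top at_top" "filterlim (\<lambda>t::real. t / exp 1) at_top at_top"
    by real_asymp+
  show "Liminf at_top (\<lambda>t. ereal (g t / ln t)) \<le> Liminf at_top (\<lambda>t. ereal (h t / ln t))"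
  proof (rule Liminf_le_Liminf_vanishing_error)
    fix b assume "\<forall>\<^sub>F t in at_top. b < g t / ln t"
    with le have "\<forall>\<^sub>F t in at_top. g t \<le> h (exp 1 * t) \<and> b < g t / ln t"
      by (rule eventually_conj)
    \<comment> \<open>The known bound concerns \<open>g\<close> and the goal concerns
      \<open>h t\<close>, so \<open>t / exp 1\<close> is substituted. For the upper limit the roles
      are exchanged and \<open>exp 1 * t\<close> is substituted.\<close>
    then have "\<forall>\<^sub>F t in at_top. g (t / exp 1) \<le> h t \<and> b < g (t / exp 1) / ln (t / exp 1)"
      using scale(2) by (auto simp: filterlim_iff)
    then have "\<forall>\<^sub>F t in at_top. b + - b / ln t \<le> h t / ln t"
      using eventually_gt_at_top[of "exp 1"]
    proof eventually_elim
      case (elim t)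
      then have "0 < t"
        using exp_gt_zero[of "1::real"] by linarith
      then have "1 < ln t"
        using ln_less_cancel_iff[of "exp 1" t] elim by simp
      moreover have "ln (t / exp 1) = ln t - 1"
        using \<open>0 < t\<close> by (simp add: ln_div)
      ultimately have "b * (ln t - 1) < h t"
        using elim by (simp add: pos_less_divide_eq)
      then have "(b * (ln t - 1)) / ln t \<le> h t / ln t"
        using \<open>1 < ln t\<close> by (intro divide_right_mono) simp_all
      then show ?case
        using \<open>1 < ln t\<close> by (simp add: right_diff_distrib diff_divide_distrib)
    qed
    then show "\<exists>r. (r \<longlongrightarrow> 0) at_top \<and> (\<forall>\<^sub>F t in at_top. b + r t \<le> h t / ln t)"
      using r by blast
  qed
  show "Limsup at_top (\<lambda>t. ereal (g t / ln t)) \<le> Limsup at_top (\<lambda>t. ereal (h t / ln t))"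
  proof (rule Limsup_le_Limsup_vanishing_error)
    fix b assume "\<forall>\<^sub>F t in at_top. h t / ln t < b"
    then have "\<forall>\<^sub>F t in at_top. h (exp 1 * t) / ln (exp 1 * t) < b"
      using scale(1) by (auto simp: filterlim_iff)
    then have "\<forall>\<^sub>F t in at_top. g t / ln t \<le> b + b / ln t"
      using le eventually_gt_at_top[of 1]
    proof eventually_elim
      case (elim t)
      then have "0 < ln t" "ln (exp 1 * t) = ln t + 1"
        by (simp_all add: ln_mult)
      then have "0 < ln (exp 1 * t)"
        by linarith
      then have "h (exp 1 * t) < b * ln (exp 1 * t)"
        using elim(1) by (simp only: pos_divide_less_eq)
      then have "h (exp 1 * t) < b * (ln t + 1)"
        unfolding \<open>ln (exp 1 * t) = ln t + 1\<close> .
      then have "g t \<le> b * (ln t + 1)"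
        using elim by linarith
      then have "g t / ln t \<le> (b * (ln t + 1)) / ln t"
        using \<open>0 < ln t\<close> by (intro divide_right_mono) simp_all
      then show ?case
        using \<open>0 < ln t\<close> by (simp add: distrib_left add_divide_distrib)
    qed
    then show "\<exists>r. (r \<longlongrightarrow> 0) at_top \<and> (\<forall>\<^sub>F t in at_top. g t / ln t \<le> b + r t)"
      using r by blast
  qed
qed

section \<open>A primitive \<open>L\<close> of \<open>m t / t\<close> for positive increasing
  \<open>m\<close>\<close>

context
  fixes L m :: "real \<Rightarrow> real"
  assumes der: "\<And>t. 0 < t \<Longrightarrow> (L has_real_derivative m t / t) (at t)"
    and pos: "\<And>t. 0 < t \<Longrightarrow> 0 < m t"
    and mono: "\<And>s t. 0 < s \<Longrightarrow> s \<le> t \<Longrightarrow> m s \<le> m t"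
begin

text \<open>Since \<open>m\<close> is at least \<open>m 1 > 0\<close> on [1, \<infinity>),
  \<open>L\<close> grows at least like \<open>m 1 * ln t\<close>.\<close>

lemma eventually_primitive_pos: "\<forall>\<^sub>F t in at_top. 0 < L t"
proof -
  have "filterlim (\<lambda>t. L 1 + m 1 * ln t) at_top at_top"
    using pos[of 1] by real_asymp
  then have "\<forall>\<^sub>F t in at_top. 0 < L 1 + m 1 * ln t"
    by (simp add: filterlim_at_top_dense)
  then show ?thesis
    using eventually_ge_at_top[of 1]
  proof eventually_elim
    case (elim t)
    then have "m 1 * (ln t - ln 1) \<le> L t - L 1"
      by (intro mult_ln_le_diff[where h' = m]) (auto intro: der mono)
    with elim show ?case
      by simp
  qed
qed

text \<open>The interval from \<open>t\<close> to \<open>exp 1 * t\<close> has logarithmic length 1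
  and \<open>m\<close> is at least \<open>m t\<close> on it, so \<open>L\<close> gains at least
  \<open>m t\<close> there; the positive value \<open>L t\<close> is dropped.\<close>

lemma eventually_ln_le_ln_primitive_dilated: "\<forall>\<^sub>F t in at_top. ln (m t) \<le> ln (L (exp 1 * t))"
  using eventually_primitive_pos eventually_gt_at_top[of 0]
proof eventually_elim
  case (elim t)
  have "m t * (ln (exp 1 * t) - ln t) \<le> L (exp 1 * t) - L t"
    using elim by (intro mult_ln_le_diff[where h' = m]) (auto intro: der mono)
  then have "m t \<le> L (exp 1 * t)"
    using elim by (simp add: ln_mult)
  then show ?case
    using pos[of t] elim by simp
qed

text \<open>Integrating from 1 to \<open>t\<close> with \<open>m\<close> bounded by its last value
  gives \<open>L t \<le> L 1 + m t * ln t\<close>, and the factor \<open>ln t\<close> contributes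
  only \<open>ln (ln t) / ln t\<close> to the quotient.\<close>

lemma Limsup_ln_primitive_le:
  "Limsup at_top (\<lambda>t. ereal (ln (L t) / ln t)) \<le> Limsup at_top (\<lambda>t. ereal (ln (m t) / ln t))"
proof (rule Limsup_le_Limsup_vanishing_error)
  fix b assume b: "\<forall>\<^sub>F t in at_top. ln (m t) / ln t < b"
  \<comment> \<open>For \<open>t > exp 1\<close> the product \<open>m t * ln t\<close> exceeds
    \<open>m 1\<close>, so the first summand of \<open>K\<close> absorbs \<open>L 1\<close>; the
    summand 1 accounts for the integral.\<close>
  define K where "K = \<bar>L 1\<bar> / m 1 + 1"
  have K: "0 < K"
    using pos[of 1] by (simp add: K_def add_nonneg_pos)
  let ?r = "\<lambda>t. (ln K + ln (ln t)) / ln t"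
  have "(?r \<longlongrightarrow> 0) at_top"
    by real_asymp
  moreover have "\<forall>\<^sub>F t in at_top. ln (L t) / ln t \<le> b + ?r t"
    using b eventually_primitive_pos eventually_gt_at_top[of "exp 1"]
  proof eventually_elim
    case (elim t)
    have t: "1 < t"
      using elim(3) one_less_exp_iff[of "1::real"] by linarith
    have ln: "1 < ln t"
      using elim(3) t ln_less_cancel_iff[of "exp 1" t] by simp
    have m: "0 < m t" "m 1 \<le> m t"
      using t pos mono by auto
    have "L t - L 1 \<le> m t * (ln t - ln 1)"
      using t by (intro diff_le_mult_ln[where h' = m]) (auto intro: der mono)
    moreover have "L 1 \<le> \<bar>L 1\<bar> / m 1 * (m t * ln t)"
    proof -
      have "L 1 \<le> \<bar>L 1\<bar> / m 1 * m 1"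
        using pos[of 1] by simp
      also have "m 1 * 1 \<le> m t * ln t"
        using m ln pos[of 1] by (intro mult_mono) auto
      then have "\<bar>L 1\<bar> / m 1 * m 1 \<le> \<bar>L 1\<bar> / m 1 * (m t * ln t)"
        using pos[of 1] by (intro mult_left_mono) auto
      finally show ?thesis .
    qed
    ultimately have "L t \<le> K * (m t * ln t)"
      by (simp add: K_def algebra_simps)
    then have "ln (L t) \<le> ln (K * (m t * ln t))"
      using elim(2) by simp
    also have "\<dots> = ln K + (ln (m t) + ln (ln t))"
      using K m ln by (simp add: ln_mult)
    finally show ?case
      using elim(1) ln by (simp add: field_simps)
  qed
  ultimately show "\<exists>r. (r \<longlongrightarrow> 0) at_top \<and> (\<forall>\<^sub>F t in at_top. ln (L t) / ln t \<le> b + r t)"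
    by blast
qed

end

section \<open>Mean and logarithm of a function in the class\<close>

text \<open>A nonzero coefficient of index \<open>k \<ge> 1\<close> gives the series of
  \<open>euler_deriv f\<close> a positive term, and all its terms are nonnegative.\<close>

lemma khinchin_mean_pos:
  assumes "f \<in> khinchin_class" "0 < t" "ereal t < fps_conv_radius f"
  shows "0 < khinchin_mean f t"
proof -
  obtain k where k: "1 \<le> k" "fps_nth f k \<noteq> 0"
    using assms(1) by (auto simp: khinchin_class_def)
  have nonneg: "0 \<le> fps_nth f n" for n
    using assms(1) by (simp add: khinchin_class_def)
  have "summable (\<lambda>n. fps_nth (euler_deriv f) n * t ^ n)"
    using assms conv_radius_euler_deriv[of f] by (intro summable_fps) auto
  then have "0 < (\<Sum>n. fps_nth (euler_deriv f) n * t ^ n)"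
    using assms(2) nonneg k nonneg[of k]
    by (intro suminf_pos2[of _ k]) (auto simp: nth_euler_deriv less_le)
  then show ?thesis
    using khinchin_moments(2)[OF assms(1) less_imp_le[OF assms(2)] assms(3)]
      eval_fps_pos[OF assms(1) less_imp_le[OF assms(2)] assms(3)]
    by (simp add: eval_fps_def)
qed

text \<open>The derivative of the mean is the variance divided by \<open>x\<close>, hence
  nonnegative.\<close>

lemma khinchin_mean_mono:
  assumes "f \<in> khinchin_class" "0 < s" "s \<le> t" "ereal t < fps_conv_radius f"
  shows "khinchin_mean f s \<le> khinchin_mean f t"
proof (rule DERIV_nonneg_imp_nondecreasing[OF assms(3)])
  fix x assume x: "s \<le> x" "x \<le> t"
  then have "ereal x < fps_conv_radius f"
    using assms(4) by (meson ereal_less_eq(3) le_less_trans)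
  then have "(khinchin_mean f has_real_derivative khinchin_variance f x / x) (at x)"
    using x assms by (intro khinchin_mean_has_derivative) auto
  moreover have "0 \<le> khinchin_variance f x / x"
    using x assms(2) by (simp add: khinchin_variance_def measure_pmf.variance_positive)
  ultimately show "\<exists>y. (khinchin_mean f has_real_derivative y) (at x) \<and> 0 \<le> y"
    by blast
qed

text \<open>This lets \<open>ln f\<close> and the mean take the places of \<open>L\<close> and
  \<open>m\<close> above.\<close>

lemma ln_eval_fps_has_derivative:
  assumes "f \<in> khinchin_class" "0 < t" "ereal t < fps_conv_radius f"
  shows "((\<lambda>t. ln (eval_fps f t)) has_real_derivative khinchin_mean f t / t) (at t)"
proof -
  have "0 < eval_fps f t"
    using assms by (intro eval_fps_pos) auto
  moreover have "(eval_fps f has_real_derivative eval_fps (fps_deriv f) t) (at t)"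
    using assms by (intro has_field_derivative_eval_fps) auto
  moreover have "khinchin_mean f t / t = eval_fps (fps_deriv f) t / eval_fps f t"
    using khinchin_moments(2)[of f t] eval_euler_deriv[of t f] assms by simp
  ultimately show ?thesis
    by (auto intro!: derivative_eq_intros simp: field_simps)
qed

theorem proposition5p3:
  fixes f :: "real fps"
  assumes "f \<in> khinchin_class" and "entire_fps f"
  shows "Liminf at_top (\<lambda>t. ereal (khinchin_variance f t / khinchin_mean f t))
           \<le> Liminf at_top (\<lambda>t. ereal (ln (khinchin_mean f t) / ln t))
       \<and> Liminf at_top (\<lambda>t. ereal (ln (khinchin_mean f t) / ln t))
           \<le> Liminf at_top (\<lambda>t. ereal (ln (ln (eval_fps f t)) / ln t))
       \<and> Liminf at_top (\<lambda>t. ereal (ln (ln (eval_fps f t)) / ln t))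
           \<le> Limsup at_top (\<lambda>t. ereal (ln (ln (eval_fps f t)) / ln t))
       \<and> Limsup at_top (\<lambda>t. ereal (ln (ln (eval_fps f t)) / ln t))
           = Limsup at_top (\<lambda>t. ereal (ln (khinchin_mean f t) / ln t))
       \<and> Limsup at_top (\<lambda>t. ereal (ln (khinchin_mean f t) / ln t)) = fps_order f
       \<and> fps_order f
           \<le> Limsup at_top (\<lambda>t. ereal (khinchin_variance f t / khinchin_mean f t))"
proof -
  have R: "ereal t < fps_conv_radius f" for t
    using assms(2) by (simp add: entire_fps_def)
  note dL = ln_eval_fps_has_derivative[OF assms(1) _ R]
  note pos = khinchin_mean_pos[OF assms(1) _ R]
  note mono = khinchin_mean_mono[OF assms(1) _ _ R]
  \<comment> \<open>With \<open>h\<close> the logarithm of the mean, \<open>h'\<close> is the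
    variance over the mean, which yields both ends of the chain.\<close>
  have dm: "((\<lambda>t. ln (khinchin_mean f t)) has_real_derivative
      (khinchin_variance f t / khinchin_mean f t) / t) (at t)" if "0 < t" for t
    using khinchin_mean_has_derivative[OF assms(1) that R] pos[OF that] that
    by (auto intro!: derivative_eq_intros simp: field_simps)
  note shift = Liminf_Limsup_div_ln_le_dilated[OF eventually_ln_le_ln_primitive_dilated[OF dL pos mono]]
  have eq: "Limsup at_top (\<lambda>t. ereal (ln (ln (eval_fps f t)) / ln t))
      = Limsup at_top (\<lambda>t. ereal (ln (khinchin_mean f t) / ln t))"
    by (rule antisym[OF Limsup_ln_primitive_le[OF dL pos mono] shift(2)])
  \<comment> \<open>As the coefficients are nonnegative, the maximum modulus on the circle of radius
    \<open>t \<ge> 0\<close> is attained at \<open>t\<close> itself.\<close>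
  have order: "fps_order f = Limsup at_top (\<lambda>t. ereal (ln (ln (eval_fps f t)) / ln t))"
    unfolding fps_order_def
    by (intro Limsup_eq eventually_at_top_linorderI[of 0]) (simp add: max_modulus_eq[OF assms(1) _ R])
  show ?thesis
    using Liminf_log_derivative_le[OF dm] Limsup_le_log_derivative[OF dm] shift(1) eq order
      Liminf_le_Limsup[of at_top "\<lambda>t. ereal (ln (ln (eval_fps f t)) / ln t)"]
    by simp
qed

end
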